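(* Let $N\ge 1$ be an integer, let $b>1$ be the buy cost, and let the prior be uniform: $\pi_k = 1/N$ for $k\in\{1,\dots,N\}$ (so the horizon bound is $M=N$). Then the Bayesian ski rental algorithm with buy cost $b$ and prior $\pi$ has expected competitive ratio \[ \mathrm{ECR} = \begin{cases} 1, & \text{if } N \leq b, \\[4pt] \dfrac{N(N + 1)}{b(2N - b + 1)}, & \text{if } b < N < 2b - 1, \\[8pt] \dfrac{2N}{2N - b + 1}, & \text{if } N \geq 2b - 1. \end{cases} \]
   Context: Ski rental: the unknown season length (horizon) $T\in\{1,\dots,M\}$ has prior $\Pr[T=k]=\pi_k\ge 0$ with $\sum_{k=1}^M\pi_k=1$. Renting costs $1$ per day; buying costs a one-time amount $b>1$ and then use is free. For $t\in\{1,\dots,M\}$ put $Z_t=\sum_{k=t}^M\pi_k$ and, when $Z_t>0$, define the expected remaining rental cost \[E_{\mathrm{rent}}(t)=\sum_{k=t}^M \frac{\pi_k}{Z_t}\,(k-t+1).\] Bayesian algorithm: it buys on the first day $t$ with $Z_t>0$ and $b\le E_{\mathrm{rent}}(t)$, and rents on every day before that. Its purchase day $t^*$ is this first day $t$, with $t^*=M+1$ if there is no such day (never buy). Expected competitive ratio (ratio of the algorithm's expected cost to the expected offline optimal cost, the offline optimal cost for horizon $k$ being $\min(k,b)$): \[ \mathrm{ECR}=\frac{\sum_{k=1}^{t^*-1}\pi_k\,k+\sum_{k=t^*}^{M}\pi_k\,(t^*-1+b)}{\sum_{k=1}^{M}\pi_k\min(k,b)}. \]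
   Formalization: The buy cost b is assumed to be an integer whenever b < N; for non-integer b < N the displayed formulas are false (e.g. N = 2, b = 3/2 gives ECR = 6/5, not 8/7). *)

theory Defs
  imports Complex_Main
begin

text \<open>
  A prior is a function \<open>\<pi> :: nat \<Rightarrow> real\<close>, of which only the values on \<open>{1..M}\<close>
  are used. The buy cost \<open>b\<close> is real.
\<close>

definition tail_mass :: "(nat \<Rightarrow> real) \<Rightarrow> nat \<Rightarrow> nat \<Rightarrow> real" where
  "tail_mass \<pi> M t = (\<Sum>k=t..M. \<pi> k)"

text \<open>Meaningful only where \<open>tail_mass \<pi> M t > 0\<close>.\<close>

definition expected_rent :: "(nat \<Rightarrow> real) \<Rightarrow> nat \<Rightarrow> nat \<Rightarrow> real" where
  "expected_rent \<pi> M t = (\<Sum>k=t..M. \<pi> k / tail_mass \<pi> M t * (real k - real t + 1))"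

definition buys_at :: "(nat \<Rightarrow> real) \<Rightarrow> nat \<Rightarrow> real \<Rightarrow> nat \<Rightarrow> bool" where
  "buys_at \<pi> M b t \<longleftrightarrow> t \<in> {1..M} \<and> tail_mass \<pi> M t > 0 \<and> b \<le> expected_rent \<pi> M t"

text \<open>The value \<open>M + 1\<close> encodes never buying.\<close>

definition purchase_day :: "(nat \<Rightarrow> real) \<Rightarrow> nat \<Rightarrow> real \<Rightarrow> nat" where
  "purchase_day \<pi> M b =
     (if \<exists>t. buys_at \<pi> M b t then LEAST t. buys_at \<pi> M b t else M + 1)"

text \<open>Expected cost of renting before day \<open>s\<close> and buying on day \<open>s\<close>.\<close>

definition expected_cost :: "(nat \<Rightarrow> real) \<Rightarrow> nat \<Rightarrow> real \<Rightarrow> nat \<Rightarrow> real" where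
  "expected_cost \<pi> M b s =
     (\<Sum>k=1..<s. \<pi> k * real k) + (\<Sum>k=s..M. \<pi> k * (real s - 1 + b))"

definition expected_opt :: "(nat \<Rightarrow> real) \<Rightarrow> nat \<Rightarrow> real \<Rightarrow> real" where
  "expected_opt \<pi> M b = (\<Sum>k=1..M. \<pi> k * min (real k) b)"

definition ECR :: "(nat \<Rightarrow> real) \<Rightarrow> nat \<Rightarrow> real \<Rightarrow> real" where
  "ECR \<pi> M b = expected_cost \<pi> M b (purchase_day \<pi> M b) / expected_opt \<pi> M b"

end

(* Under the uniform prior the expected remaining rental cost is (N - t + 2) / 2, which is decreasing
   in t.  Hence the algorithm buys on day 1 if N >= 2 b - 1 and never buys otherwise, and both costs
   are arithmetic sums. *)

theory Submission
  imports Defs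
begin

text \<open>Substituting \<open>j = k - t + 1\<close> gives the triangular sum of 1 up to
  \<open>n - t + 1\<close>. The bound \<open>t \<le> Suc n\<close> admits the empty range, where the
  first factor on the right vanishes.\<close>

lemma sum_shifted_arith:
  assumes "t \<le> Suc n"
  shows "(\<Sum>k=t..n. real k - real t + 1) = (real n - real t + 1) * (real n - real t + 2) / 2"
  using assms
proof (induction n)
  case 0
  then consider "t = 0" | "t = 1" by linarith
  then show ?case by cases auto
next
  case (Suc n)
  show ?case
  \<comment> \<open>The empty range is the one case that the induction hypothesis does not
    cover.\<close>
  proof (cases "t = Suc (Suc n)")
    case True
    then show ?thesis by simp
  next
    case False
    with Suc.prems have "t \<le> Suc n" by simp
    with Suc.IH show ?thesis by (simp add: field_simps)
  qed
qed

lemma sum_real_from_1: "(\<Sum>k=1..n. real k) = real n * (real n + 1) / 2"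
  using sum_shifted_arith[of 1 n] by (simp add: algebra_simps)

text \<open>With a natural cap \<open>m\<close>, the terms up to \<open>m\<close> form a triangular
  sum and each later term adds exactly \<open>m\<close>; hence the induction starts at
  \<open>n = m\<close>.\<close>

lemma sum_min_of_nat:
  assumes "m \<le> n"
  shows "(\<Sum>k=1..n. min (real k) (real m)) = real m * (2 * real n - real m + 1) / 2"
  using assms
proof (induction n rule: dec_induct)
  case base
  have "(\<Sum>k=1..m. min (real k) (real m)) = (\<Sum>k=1..m. real k)"
    by (rule sum.cong) auto
  then show ?case unfolding sum_real_from_1 by (simp add: algebra_simps)
next
  case (step n)
  then show ?case by (simp add: field_simps)
qed

locale uniform_prior =
  fixes N :: nat and \<pi> :: "nat \<Rightarrow> real"
  assumes N_pos: "N \<ge> 1"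
    and prior: "\<And>k. k \<in> {1..N} \<Longrightarrow> \<pi> k = 1 / real N"
begin

lemma sum_prior_mult:
  assumes "t \<ge> 1"
  shows "(\<Sum>k=t..N. \<pi> k * f k) = (\<Sum>k=t..N. f k) / real N"
  unfolding sum_divide_distrib by (rule sum.cong) (use assms prior in auto)

lemma tail_mass_uniform:
  assumes "t \<in> {1..N}"
  shows "tail_mass \<pi> N t = (real N - real t + 1) / real N"
  using sum_prior_mult[of t "\<lambda>_. 1"] assms by (simp add: tail_mass_def of_nat_diff)

text \<open>Conditioned on reaching day \<open>t\<close>, the number of remaining rental days is
  uniform on 1 to \<open>N - t + 1\<close>, and the mean of that range is its midpoint.\<close>

lemma expected_rent_uniform:
  assumes "t \<in> {1..N}"
  shows "expected_rent \<pi> N t = (real N - real t + 2) / 2"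
proof -
  define x where "x = real N - real t + 1"
  have x_pos: "x > 0" using assms by (simp add: x_def)
  have "expected_rent \<pi> N t
      = (\<Sum>k=t..N. \<pi> k * (real k - real t + 1)) / tail_mass \<pi> N t"
    by (simp add: expected_rent_def sum_divide_distrib)
  also have "\<dots> = (x * (x + 1) / 2 / real N) / (x / real N)"
  proof -
    have "real N - real t + 2 = x + 1" by (simp add: x_def)
    then show ?thesis
      using assms by (simp add: sum_prior_mult sum_shifted_arith tail_mass_uniform flip: x_def)
  qed
  also have "\<dots> = (x + 1) / 2"
    using x_pos N_pos by simp
  also have "\<dots> = (real N - real t + 2) / 2"
    by (simp add: x_def)
  finally show ?thesis .
qed

lemma buys_at_uniform:
  "buys_at \<pi> N b t \<longleftrightarrow> t \<in> {1..N} \<and> b \<le> (real N - real t + 2) / 2"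
  unfolding buys_at_def
  using N_pos by (auto simp: tail_mass_uniform expected_rent_uniform)

lemma purchase_day_uniform:
  "purchase_day \<pi> N b = (if 2 * b - 1 \<le> real N then 1 else N + 1)"
proof (cases "2 * b - 1 \<le> real N")
  case True
  then have 1: "buys_at \<pi> N b 1" using N_pos by (auto simp: buys_at_uniform)
  moreover have "(LEAST t. buys_at \<pi> N b t) = 1"
    using 1 by (intro Least_equality) (auto simp: buys_at_uniform)
  ultimately show ?thesis using True unfolding purchase_day_def by auto
next
  case False
  \<comment> \<open>Since \<open>t \<ge> 1\<close>, the expected rent on any day is at most its
    day-1 value \<open>(N + 1) / 2\<close>, which is below \<open>b\<close>.\<close>
  then have "\<not> buys_at \<pi> N b t" for t by (auto simp: buys_at_uniform)
  with False show ?thesis by (simp add: purchase_day_def)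
qed

lemma expected_cost_buy_first: "expected_cost \<pi> N b 1 = b"
  using N_pos sum_prior_mult[of 1 "\<lambda>_. b"] by (simp add: expected_cost_def)

lemma expected_cost_never: "expected_cost \<pi> N b (N + 1) = (real N + 1) / 2"
proof -
  have "expected_cost \<pi> N b (N + 1) = (\<Sum>k=1..N. \<pi> k * real k)"
    by (simp add: expected_cost_def atLeastLessThanSuc_atLeastAtMost)
  then show ?thesis
    unfolding sum_prior_mult[OF order_refl] sum_real_from_1 using N_pos by simp
qed

lemma expected_opt_rent:
  assumes "real N \<le> b"
  shows "expected_opt \<pi> N b = (real N + 1) / 2"
proof -
  have "(\<Sum>k=1..N. min (real k) b) = (\<Sum>k=1..N. real k)"
    by (rule sum.cong) (use assms in auto)
  then show ?thesis
    unfolding expected_opt_def sum_prior_mult[OF order_refl] sum_real_from_1 using N_pos by simp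
qed

lemma expected_opt_of_nat:
  assumes "m \<le> N"
  shows "expected_opt \<pi> N (real m) = real m * (2 * real N - real m + 1) / (2 * real N)"
  unfolding expected_opt_def sum_prior_mult[OF order_refl] sum_min_of_nat[OF assms] by simp

end

theorem theorem1:
  fixes N :: nat and b :: real and \<pi> :: "nat \<Rightarrow> real"
  assumes "N \<ge> 1"
    and "b > 1"
    and "b < real N \<Longrightarrow> b \<in> \<int>"
    and "\<And>k. k \<in> {1..N} \<Longrightarrow> \<pi> k = 1 / real N"
  shows "ECR \<pi> N b =
    (if real N \<le> b then 1
     else if real N < 2 * b - 1 then real N * (real N + 1) / (b * (2 * real N - b + 1))
     else 2 * real N / (2 * real N - b + 1))"
proof -
  interpret uniform_prior N \<pi>
    using assms by unfold_locales
  show ?thesis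
  proof (cases "real N \<le> b")
    case True
    \<comment> \<open>From \<open>b > 1\<close> follows \<open>2 * b - 1 > b \<ge> N\<close>, so the
      algorithm never buys, just like the offline optimum.\<close>
    with assms(2) have "purchase_day \<pi> N b = N + 1" by (simp add: purchase_day_uniform)
    then have "ECR \<pi> N b = ((real N + 1) / 2) / ((real N + 1) / 2)"
      unfolding ECR_def by (simp only: expected_cost_never expected_opt_rent[OF True])
    with True show ?thesis by simp
  next
    case False
    \<comment> \<open>Integrality matters here: for fractional \<open>b\<close> with
      \<open>b < N\<close>, the sum of \<open>min k b\<close> differs from
      \<open>b * (2 * N - b + 1) / 2\<close> by a nonzero term in the fractional part of
      \<open>b\<close>.\<close>
    with assms(3) have "b \<in> \<int>" by simp
    with assms(2) have "b \<in> \<nat>" by (simp add: Nats_altdef2)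
    then obtain m where m: "b = real m" by (rule Nats_cases)
    have opt: "expected_opt \<pi> N b = b * (2 * real N - b + 1) / (2 * real N)"
      using False m by (simp add: expected_opt_of_nat)
    show ?thesis
    proof (cases "real N < 2 * b - 1")
      case True
      then have "ECR \<pi> N b = ((real N + 1) / 2) / (b * (2 * real N - b + 1) / (2 * real N))"
        unfolding ECR_def opt purchase_day_uniform using expected_cost_never[of b] by simp
      with True False show ?thesis by (simp add: mult.commute)
    next
      case buy: False
      then have "ECR \<pi> N b = b / (b * (2 * real N - b + 1) / (2 * real N))"
        unfolding ECR_def opt purchase_day_uniform using expected_cost_buy_first[of b] by simp
      with buy False assms(2) show ?thesis by simp
    qed
  qed
qed

end
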